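(* Let $\mathfrak K=\langle U,\mathcal L,\mathrel{|}\rangle\in\mathscr B(k,m)$ and let $\mathcal H$ be a hyperplane of $\mathfrak K$. Assume that (i) $\mathcal H$ is a configuration (in this case this means simply that $\mathfrak K\restriction\mathcal H$ has constant point rank), and (ii) $\mathfrak K\setminus\mathcal H$ is a binomial configuration. Then: (iii) $\mathcal H$ is a binomial configuration, more precisely: $\mathfrak K_2:=\mathfrak K\restriction\mathcal H\in\mathscr B(k-1,m)$; (iv) $\mathfrak K_1:=\mathfrak K\setminus\mathcal H\in\mathscr B(k,m-1)$; (v) there is a one-to-one correspondence (bijection) $\infty$ from the lines of $\mathfrak K_1$ to the points of $\mathfrak K_2$ such that $\mathfrak K=\mathfrak K_1\rtimes_\infty\mathfrak K_2$.
   Context: An incidence structure $\mathfrak K=\langle U,\mathcal L,\mathrel{|}\rangle$ consists of a set $U$ of points, a set $\mathcal L$ of lines and an incidence relation $\mathrel{|}\subset U\times\mathcal L$. It is a partial linear space if, whenever points $a,b$ are both incident with lines $A,B$, then $a=b$ or $A=B$. The rank of a point is the number of lines incident with it; the size of a line is the number of points incident with it. A $(\nu_\rho\,\beta_\kappa)$-configuration is a partial linear space with exactly $\nu$ points, exactly $\beta$ lines, every point of rank $\rho$ and every line of size $\kappa$. For positive integers $k,m$, $\mathscr B(k,m)$ denotes the class of all $\left(\binom{k+m-1}{k}_{k}\,\binom{k+m-1}{m}_{m}\right)$-configurations, i.e. those with $\binom{k+m-1}{k}$ points, each of rank $k$, and $\binom{k+m-1}{m}$ lines, each of size $m$. A configuration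 is binomial if it is in $\mathscr B(k,m)$ for some positive integers $k,m$. A hyperplane of $\mathfrak K$ is a proper subset $\mathcal H\subsetneq U$ such that: (a) $\mathcal H$ is a subspace, i.e. if two distinct points of $\mathcal H$ are incident with a line $A$, then all points incident with $A$ are in $\mathcal H$; and (b) every line of $\mathfrak K$ is incident with at least one point of $\mathcal H$. Let $\mathcal L[\mathcal H]$ be the set of lines all of whose points are in $\mathcal H$. Then $\mathfrak K\restriction\mathcal H:=\langle\mathcal H,\mathcal L[\mathcal H],\mathrel{|}\cap(\mathcal H\times\mathcal L[\mathcal H])\rangle$ (the hyperplane $\mathcal H$ is identified with this structure) and $\mathfrak K\setminus\mathcal H:=\langle U\setminus\mathcal H,\ \mathcal L\setminus\mathcal L[\mathcal H],\ \mathrel{|}\cap((U\setminus\mathcal H)\times(\mathcal L\setminus\mathcal L[\mathcal H]))\rangle$. Given partial linear spaces $\mathfrak K_i=\langle U_i,\mathcal L_i,\mathrel{|_i}\rangle$, $i=1,2$, with $U_1\cap U_2=\emptyset=\mathcal L_1\cap\mathcal L_2$, and a map $\infty\colon\mathcal L_1\to U_2$, $A\mapsto A^\infty$, such that two lines $A,B\in\mathcal L_1$ which have a common point in $U_1$ and satisfy $A^\infty=B^\infty$ are equal, the structure $\mathfrak K_1\rtimes_\infty\mathfrak K_2$ is $\langle U_1\cup U_2,\ \mathcal L_1\cup\mathcal L_2,\ \mathrel{|_1}\cup\mathrel{|_2}\cup\{(A^\infty,A)\colon A\in\mathcal L_1\}\rangle$.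
   Formalization: That H is a binomial configuration is asserted only for k ≥ 2, since for k = 1 it is a single point of rank 0, which is in no B(k,m) with positive parameters; for k = 1, membership in B(k-1,m) is read by the defining formula with k-1 = 0. *)

theory Defs
  imports Complex_Main
begin

record ('p, 'l) incidence_structure =
  points :: "'p set"
  lines :: "'l set"
  incid :: "('p \<times> 'l) set"

definition incidence_structure :: "('p, 'l) incidence_structure \<Rightarrow> bool" where
  "incidence_structure K \<longleftrightarrow> incid K \<subseteq> points K \<times> lines K"

definition partial_linear_space :: "('p, 'l) incidence_structure \<Rightarrow> bool" where
  "partial_linear_space K \<longleftrightarrow> incidence_structure K \<and>
     (\<forall>a b A B. (a, A) \<in> incid K \<and> (b, A) \<in> incid K \<and> (a, B) \<in> incid K \<and> (b, B) \<in> incid K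
        \<longrightarrow> a = b \<or> A = B)"

definition point_rank :: "('p, 'l) incidence_structure \<Rightarrow> 'p \<Rightarrow> nat" where
  "point_rank K a = card {A \<in> lines K. (a, A) \<in> incid K}"

definition line_size :: "('p, 'l) incidence_structure \<Rightarrow> 'l \<Rightarrow> nat" where
  "line_size K A = card {a \<in> points K. (a, A) \<in> incid K}"

text \<open>The finiteness conditions exclude infinite sets, whose \<open>card\<close> is \<open>0\<close>; they also make all
  ranks and sizes genuine cardinalities.\<close>

definition configuration_params ::
    "nat \<Rightarrow> nat \<Rightarrow> nat \<Rightarrow> nat \<Rightarrow> ('p, 'l) incidence_structure \<Rightarrow> bool" where
  "configuration_params \<nu> \<rho> \<beta> \<kappa> K \<longleftrightarrow>
     partial_linear_space K \<and>
     finite (points K) \<and> card (points K) = \<nu> \<and>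
     finite (lines K) \<and> card (lines K) = \<beta> \<and>
     (\<forall>a \<in> points K. point_rank K a = \<rho>) \<and>
     (\<forall>A \<in> lines K. line_size K A = \<kappa>)"

definition configuration :: "('p, 'l) incidence_structure \<Rightarrow> bool" where
  "configuration K \<longleftrightarrow> (\<exists>\<nu> \<rho> \<beta> \<kappa>. configuration_params \<nu> \<rho> \<beta> \<kappa> K)"

text \<open>The class \<open>\<B>(k,m)\<close>. The defining formula is also used for \<open>k = 0\<close>, \<open>m \<ge> 1\<close>, where it
  describes a single point of rank 0 and no lines; positivity of the parameters is required
  separately in \<open>binomial_configuration\<close>.\<close>

definition binomial_class :: "nat \<Rightarrow> nat \<Rightarrow> ('p, 'l) incidence_structure set" where
  "binomial_class k m =
     {K. configuration_params ((k + m - 1) choose k) k ((k + m - 1) choose m) m K}"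

definition binomial_configuration :: "('p, 'l) incidence_structure \<Rightarrow> bool" where
  "binomial_configuration K \<longleftrightarrow> (\<exists>k m. 0 < k \<and> 0 < m \<and> K \<in> binomial_class k m)"

definition subspace_of :: "'p set \<Rightarrow> ('p, 'l) incidence_structure \<Rightarrow> bool" where
  "subspace_of H K \<longleftrightarrow> H \<subseteq> points K \<and>
     (\<forall>A \<in> lines K. \<forall>a \<in> H. \<forall>b \<in> H.
        a \<noteq> b \<and> (a, A) \<in> incid K \<and> (b, A) \<in> incid K \<longrightarrow> (\<forall>c. (c, A) \<in> incid K \<longrightarrow> c \<in> H))"

definition hyperplane :: "'p set \<Rightarrow> ('p, 'l) incidence_structure \<Rightarrow> bool" where
  "hyperplane H K \<longleftrightarrow> H \<subset> points K \<and> subspace_of H K \<and>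
     (\<forall>A \<in> lines K. \<exists>a \<in> H. (a, A) \<in> incid K)"

definition lines_within :: "('p, 'l) incidence_structure \<Rightarrow> 'p set \<Rightarrow> 'l set" where
  "lines_within K H = {A \<in> lines K. \<forall>a. (a, A) \<in> incid K \<longrightarrow> a \<in> H}"

definition restrict_to :: "('p, 'l) incidence_structure \<Rightarrow> 'p set \<Rightarrow> ('p, 'l) incidence_structure" where
  "restrict_to K H =
     \<lparr>points = H, lines = lines_within K H, incid = incid K \<inter> (H \<times> lines_within K H)\<rparr>"

definition remove_hyperplane ::
    "('p, 'l) incidence_structure \<Rightarrow> 'p set \<Rightarrow> ('p, 'l) incidence_structure" where
  "remove_hyperplane K H =
     \<lparr>points = points K - H, lines = lines K - lines_within K H,
      incid = incid K \<inter> ((points K - H) \<times> (lines K - lines_within K H))\<rparr>"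

text \<open>The data for which \<open>K1 \<rtimes>\<^sub>f K2\<close> is defined: disjoint partial linear spaces and a map \<open>f\<close> from
  the lines of \<open>K1\<close> to the points of \<open>K2\<close>, injective on the lines through any point of \<open>K1\<close>.\<close>

definition gluing_data ::
    "('p, 'l) incidence_structure \<Rightarrow> ('l \<Rightarrow> 'p) \<Rightarrow> ('p, 'l) incidence_structure \<Rightarrow> bool" where
  "gluing_data K1 f K2 \<longleftrightarrow>
     partial_linear_space K1 \<and> partial_linear_space K2 \<and>
     points K1 \<inter> points K2 = {} \<and> lines K1 \<inter> lines K2 = {} \<and>
     f ` lines K1 \<subseteq> points K2 \<and>
     (\<forall>A \<in> lines K1. \<forall>B \<in> lines K1.
        (\<exists>a \<in> points K1. (a, A) \<in> incid K1 \<and> (a, B) \<in> incid K1) \<and> f A = f B \<longrightarrow> A = B)"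

definition gluing ::
    "('p, 'l) incidence_structure \<Rightarrow> ('l \<Rightarrow> 'p) \<Rightarrow> ('p, 'l) incidence_structure
      \<Rightarrow> ('p, 'l) incidence_structure" where
  "gluing K1 f K2 =
     \<lparr>points = points K1 \<union> points K2, lines = lines K1 \<union> lines K2,
      incid = incid K1 \<union> incid K2 \<union> {(f A, A) |A. A \<in> lines K1}\<rparr>"

end

theory Submission
  imports Defs
begin

text \<open>A line not contained in \<open>H\<close> meets \<open>H\<close> in exactly one point, so deleting \<open>H\<close> keeps the rank of
  every remaining point and lowers the size of every remaining line by one; as the parameters of a
  binomial configuration are determined by rank and size, \<open>K - H\<close> lies in \<open>\<B>(k, m - 1)\<close>. By Pascal's
  rule the number of points and of lines of \<open>H\<close> are those of \<open>\<B>(k - 1, m)\<close>, and counting flags forces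
  the constant rank in \<open>H\<close> to be \<open>k - 1\<close>. Hence each point of \<open>H\<close> is on exactly one line not
  contained in \<open>H\<close>, and sending such a line to its point in \<open>H\<close> is the required bijection.\<close>

text \<open>Double counting of the incident point-line pairs, by points on the left and by lines on
  the right.\<close>

lemma configuration_params_flag_count:
  assumes "configuration_params \<nu> \<rho> \<beta> \<kappa> K"
  shows "\<nu> * \<rho> = \<beta> * \<kappa>"
proof -
  have "(\<Sum>a\<in>points K. point_rank K a) = \<kappa> * card (lines K)"
    unfolding point_rank_def
    by (rule sum_multicount)
      (use assms in \<open>auto simp: configuration_params_def line_size_def\<close>)
  then show ?thesis
    using assms by (simp add: configuration_params_def mult.commute)
qed

text \<open>Identifies the rank in \<open>H\<close> once the flags of \<open>H\<close> are counted.
  With \<open>n = k + m - 2\<close>, absorption turns the left side into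
  \<open>(n - (m - 1)) * (n choose (m - 1))\<close>; here \<open>n - (m - 1) = k - 1\<close>, and
  symmetry of the binomial coefficient does the rest.\<close>

lemma binomial_line_count:
  assumes "0 < k" and "0 < m"
  shows "m * ((k + m - 2) choose m) = (k - 1) * ((k + m - 2) choose (k - 1))"
proof -
  obtain i where k: "k = Suc i" using assms(1) gr0_implies_Suc by blast
  obtain j where m: "m = Suc j" using assms(2) gr0_implies_Suc by blast
  have "Suc j * ((i + j) choose Suc j) = (i + j - j) * ((i + j) choose j)"
    by (metis binomial_absorb_comp binomial_absorption)
  also have "(i + j) choose j = (i + j) choose i"
    using binomial_symmetric[of j "i + j"] by simp
  finally show ?thesis by (simp add: k m)
qed

lemma partial_linear_space_restrict_to:
  "partial_linear_space K \<Longrightarrow> partial_linear_space (restrict_to K H)"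
  unfolding partial_linear_space_def incidence_structure_def restrict_to_def by auto

lemma partial_linear_space_remove_hyperplane:
  "partial_linear_space K \<Longrightarrow> partial_linear_space (remove_hyperplane K H)"
  unfolding partial_linear_space_def incidence_structure_def remove_hyperplane_def by auto

text \<open>Existence is condition (b) of a hyperplane; a second common point would put the whole
  line into \<open>H\<close>, as \<open>H\<close> is a subspace.\<close>

lemma hyperplane_line_meets_once:
  assumes "hyperplane H K" and "A \<in> lines K - lines_within K H"
  shows "\<exists>!a. a \<in> H \<and> (a, A) \<in> incid K"
  using assms unfolding hyperplane_def subspace_of_def lines_within_def by blast

text \<open>No line through a point outside \<open>H\<close> lies within \<open>H\<close>, so none
  is deleted.\<close>

lemma point_rank_remove_hyperplane:
  assumes "a \<in> points K - H"
  shows "point_rank (remove_hyperplane K H) a = point_rank K a"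
  unfolding point_rank_def
  by (rule arg_cong[where f = card])
    (use assms in \<open>auto simp: remove_hyperplane_def lines_within_def\<close>)

lemma line_size_remove_hyperplane:
  assumes "hyperplane H K" and "A \<in> lines K - lines_within K H"
  shows "line_size (remove_hyperplane K H) A = line_size K A - 1"
proof -
  obtain p where p: "p \<in> H" "(p, A) \<in> incid K"
    "\<And>a. a \<in> H \<and> (a, A) \<in> incid K \<longleftrightarrow> a = p"
    using hyperplane_line_meets_once[OF assms] by metis
  have "H \<subseteq> points K" using assms(1) by (auto simp: hyperplane_def)
  have "{a \<in> points (remove_hyperplane K H). (a, A) \<in> incid (remove_hyperplane K H)}
      = {a \<in> points K. (a, A) \<in> incid K} - {p}"
    using p(3) assms(2) by (auto simp: remove_hyperplane_def)
  moreover have "p \<in> {a \<in> points K. (a, A) \<in> incid K}"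
    using p \<open>H \<subseteq> points K\<close> by auto
  ultimately show ?thesis
    unfolding line_size_def by (simp add: card_Diff_singleton)
qed

lemma line_size_restrict_to:
  assumes "H \<subseteq> points K" and "A \<in> lines_within K H"
  shows "line_size (restrict_to K H) A = line_size K A"
  unfolding line_size_def
  by (rule arg_cong[where f = card])
    (use assms in \<open>auto simp: restrict_to_def lines_within_def\<close>)

lemma point_rank_split:
  assumes "finite (lines K)" and "a \<in> H"
  shows "point_rank K a = point_rank (restrict_to K H) a
    + card {A \<in> lines K - lines_within K H. (a, A) \<in> incid K}"
proof -
  have within: "{A \<in> lines (restrict_to K H). (a, A) \<in> incid (restrict_to K H)}
      = {A \<in> lines_within K H. (a, A) \<in> incid K}"
    using assms(2) by (auto simp: restrict_to_def)
  have "{A \<in> lines K. (a, A) \<in> incid K} = {A \<in> lines_within K H. (a, A) \<in> incid K}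
      \<union> {A \<in> lines K - lines_within K H. (a, A) \<in> incid K}"
    by (auto simp: lines_within_def)
  then show ?thesis
    unfolding point_rank_def within using assms(1)
    by (subst card_Un_disjoint[symmetric]) (auto simp: lines_within_def)
qed

theorem theorem2p1:
  fixes K :: "('p, 'l) incidence_structure" and H :: "'p set" and k m :: nat
  assumes "0 < k" and "0 < m"
    and "K \<in> binomial_class k m"
    and "hyperplane H K"
    and "configuration (restrict_to K H)"
    and "binomial_configuration (remove_hyperplane K H)"
  shows "restrict_to K H \<in> binomial_class (k - 1) m
    \<and> (2 \<le> k \<longrightarrow> binomial_configuration (restrict_to K H))
    \<and> remove_hyperplane K H \<in> binomial_class k (m - 1)
    \<and> (\<exists>f :: 'l \<Rightarrow> 'p.
         bij_betw f (lines (remove_hyperplane K H)) (points (restrict_to K H))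
         \<and> gluing_data (remove_hyperplane K H) f (restrict_to K H)
         \<and> K = gluing (remove_hyperplane K H) f (restrict_to K H))"
proof -
  let ?K1 = "remove_hyperplane K H" and ?K2 = "restrict_to K H"
  let ?L = "lines K - lines_within K H"
  have pls: "partial_linear_space K"
    and fin: "finite (points K)" "finite (lines K)"
    and cards: "card (points K) = (k + m - 1) choose k" "card (lines K) = (k + m - 1) choose m"
    and rank: "\<And>a. a \<in> points K \<Longrightarrow> point_rank K a = k"
    and size: "\<And>A. A \<in> lines K \<Longrightarrow> line_size K A = m"
    using assms(3) by (auto simp: binomial_class_def configuration_params_def)
  have HK: "H \<subset> points K" using assms(4) by (simp add: hyperplane_def)
  have within_lines: "lines_within K H \<subseteq> lines K" by (auto simp: lines_within_def)
  have K1_sets: "points ?K1 = points K - H" "lines ?K1 = ?L"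
    and K2_sets: "points ?K2 = H" "lines ?K2 = lines_within K H"
    by (simp_all add: remove_hyperplane_def restrict_to_def)

  obtain k' m' where pos': "0 < k'" "0 < m'" and K1': "?K1 \<in> binomial_class k' m'"
    using assms(6) by (auto simp: binomial_configuration_def)
  then have K1_params:
    "configuration_params ((k' + m' - 1) choose k') k' ((k' + m' - 1) choose m') m' ?K1"
    by (simp add: binomial_class_def)
  have "k' = k"
  proof -
    \<comment> \<open>\<open>H\<close> is a proper subset, so there is a point at which the rank
      \<open>k'\<close> can be read off.\<close>
    obtain a where a: "a \<in> points K - H" using HK by blast
    then have "point_rank ?K1 a = k"
      using point_rank_remove_hyperplane rank by fastforce
    then show ?thesis using K1_params a K1_sets by (auto simp: configuration_params_def)
  qed
  have "m' = m - 1"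
  proof -
    \<comment> \<open>The size \<open>m'\<close> can be read off only if some line leaves
      \<open>H\<close>; positivity of the line count supplies one.\<close>
    have "card ?L = (k' + m' - 1) choose m'"
      using K1_params K1_sets by (simp add: configuration_params_def)
    moreover have "0 < (k' + m' - 1) choose m'"
      using pos' by (simp add: zero_less_binomial)
    ultimately have "?L \<noteq> {}" by (metis card.empty less_irrefl)
    then obtain A where A: "A \<in> ?L" by blast
    then have "line_size ?K1 A = m - 1"
      using line_size_remove_hyperplane[OF assms(4) A] size by simp
    then show ?thesis using K1_params A K1_sets by (auto simp: configuration_params_def)
  qed
  have K1: "?K1 \<in> binomial_class k (m - 1)"
    using K1' \<open>k' = k\<close> \<open>m' = m - 1\<close> by simp
  \<comment> \<open>Since \<open>m' > 0\<close>, the case \<open>m = 1\<close> is excluded and the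
    subtraction \<open>m - 1\<close> is not truncated to \<open>0\<close>.\<close>
  have m2: "2 \<le> m" using pos' \<open>m' = m - 1\<close> by simp
  have K1_cards: "card (points K - H) = (k + m - 2) choose k" "card ?L = (k + m - 2) choose (m - 1)"
    using K1 K1_sets m2 by (auto simp: binomial_class_def configuration_params_def numeral_2_eq_2)

  have n: "k + m - 1 = Suc (k + m - 2)" using m2 by simp
  have pascal: "(k + m - 1) choose k = ((k + m - 2) choose k) + ((k + m - 2) choose (k - 1))"
    "(k + m - 1) choose m = ((k + m - 2) choose m) + ((k + m - 2) choose (m - 1))"
    unfolding n using assms(1,2) choose_reduce_nat[of "Suc (k + m - 2)"]
    by (simp_all add: add.commute)
  have cardH: "card H = (k + m - 2) choose (k - 1)"
  proof -
    have "card (points K - H) = card (points K) - card H" "card H \<le> card (points K)"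
      using HK fin(1) by (auto intro: card_Diff_subset card_mono finite_subset)
    then show ?thesis using cards(1) K1_cards(1) pascal(1) by linarith
  qed
  have cardW: "card (lines_within K H) = (k + m - 2) choose m"
  proof -
    have "card ?L = card (lines K) - card (lines_within K H)"
      "card (lines_within K H) \<le> card (lines K)"
      using within_lines fin(2) by (auto intro: card_Diff_subset card_mono finite_subset)
    then show ?thesis using cards(2) K1_cards(2) pascal(2) by linarith
  qed
  have W_size: "line_size ?K2 A = m" if "A \<in> lines_within K H" for A
    using line_size_restrict_to[of H K A] that HK size within_lines by auto

  obtain \<nu> r \<beta> \<kappa> where K2_params: "configuration_params \<nu> r \<beta> \<kappa> ?K2"
    using assms(5) by (auto simp: configuration_def)
  then have \<nu>\<beta>: "\<nu> = card H" "\<beta> = card (lines_within K H)"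
    and r: "\<And>a. a \<in> H \<Longrightarrow> point_rank ?K2 a = r"
    using K2_sets by (auto simp: configuration_params_def)
  \<comment> \<open>If \<open>H\<close> contains no line, as happens for \<open>k = 1\<close>, then
    \<kappa> is arbitrary; it is therefore replaced by \<open>m\<close>, which is correct in every
    case.\<close>
  have "configuration_params (card H) r (card (lines_within K H)) m ?K2"
    using K2_params K2_sets W_size \<nu>\<beta> by (simp add: configuration_params_def)
  from configuration_params_flag_count[OF this]
  have "r * ((k + m - 2) choose (k - 1)) = (k - 1) * ((k + m - 2) choose (k - 1))"
    using binomial_line_count[OF assms(1,2)] by (simp add: cardH cardW mult.commute)
  \<comment> \<open>\<open>H\<close> is nonempty, so the common factor \<open>card H\<close>
    cancels.\<close>
  moreover have "0 < (k + m - 2) choose (k - 1)"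
    using m2 by (simp add: zero_less_binomial)
  ultimately have rk: "r = k - 1" by simp
  have exp: "k - 1 + m - 1 = k + m - 2" using assms(1) by simp
  have K2: "?K2 \<in> binomial_class (k - 1) m"
    using K2_params K2_sets W_size \<nu>\<beta> cardH cardW rk
    unfolding binomial_class_def exp by (simp add: configuration_params_def)
  \<comment> \<open>For \<open>k = 1\<close> the hyperplane is a single point without lines, which
    does not count as binomial.\<close>
  have K2': "2 \<le> k \<longrightarrow> binomial_configuration ?K2"
    unfolding binomial_configuration_def using K2 assms(2)
    by (intro impI exI[of _ "k - 1"] exI[of _ m]) auto

  have one_line: "\<exists>!A. A \<in> ?L \<and> (a, A) \<in> incid K" if "a \<in> H" for a
  proof -
    \<comment> \<open>The rank is \<open>k\<close> in \<open>K\<close> and \<open>k - 1\<close> in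
      \<open>H\<close>; the difference is \<open>1\<close> because \<open>k > 0\<close>.\<close>
    have "card {A \<in> ?L. (a, A) \<in> incid K} = 1"
      using point_rank_split[OF fin(2) that] rank r rk that HK assms(1) by auto
    then obtain B where "{A \<in> ?L. (a, A) \<in> incid K} = {B}"
      using card_1_singletonE by blast
    then have "A \<in> ?L \<and> (a, A) \<in> incid K \<longleftrightarrow> A = B" for A
      by (simp add: set_eq_iff)
    then show ?thesis by simp
  qed
  \<comment> \<open>The description is meaningful only on \<open>?L\<close>: a line within
    \<open>H\<close> has all its points there.\<close>
  define f where "f = (\<lambda>A. THE a. a \<in> H \<and> (a, A) \<in> incid K)"
  have f: "f A \<in> H" "(f A, A) \<in> incid K" if "A \<in> ?L" for A
    using theI'[OF hyperplane_line_meets_once[OF assms(4) that]] by (simp_all add: f_def)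
  have f_eq: "f A = a" if "A \<in> ?L" "a \<in> H" "(a, A) \<in> incid K" for A a
    using hyperplane_line_meets_once[OF assms(4) that(1)] f[OF that(1)] that by blast
  have inj: "inj_on f ?L"
  proof (rule inj_onI)
    fix A B assume AB: "A \<in> ?L" "B \<in> ?L" "f A = f B"
    show "A = B" using one_line[OF f(1)[OF AB(1)]] f[OF AB(1)] f[OF AB(2)] AB by auto
  qed
  moreover have "f ` ?L = H"
  proof
    show "H \<subseteq> f ` ?L" using one_line f_eq by (metis image_eqI subsetI)
  qed (use f in auto)
  ultimately have bij: "bij_betw f (lines ?K1) (points ?K2)"
    by (simp add: bij_betw_def K1_sets K2_sets)
  \<comment> \<open>Gluing asks for injectivity only on lines with a common point; \<open>f\<close>
    is injective on all of \<open>?L\<close>.\<close>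
  have data: "gluing_data ?K1 f ?K2"
    unfolding gluing_data_def
    using partial_linear_space_remove_hyperplane[OF pls] partial_linear_space_restrict_to[OF pls]
      inj \<open>f ` ?L = H\<close>
    by (auto simp: K1_sets K2_sets dest: inj_onD)
  \<comment> \<open>The three parts are: point outside \<open>H\<close>; line within
    \<open>H\<close>; point in \<open>H\<close> on a line leaving \<open>H\<close>, where the point
    must be \<open>f A\<close>.\<close>
  have "incid K = incid ?K1 \<union> incid ?K2 \<union> {(f A, A) |A. A \<in> ?L}"
  proof (intro equalityI subsetI)
    fix x assume x: "x \<in> incid K"
    obtain a A where aA: "x = (a, A)" by fastforce
    have "a \<in> points K" "A \<in> lines K"
      using x pls by (auto simp: aA partial_linear_space_def incidence_structure_def)
    moreover have "a \<in> H" if "A \<in> lines_within K H" using that x by (auto simp: aA lines_within_def)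
    ultimately show "x \<in> incid ?K1 \<union> incid ?K2 \<union> {(f A, A) |A. A \<in> ?L}"
      using x f_eq[of A a] by (auto simp: aA remove_hyperplane_def restrict_to_def)
  next
    fix x assume "x \<in> incid ?K1 \<union> incid ?K2 \<union> {(f A, A) |A. A \<in> ?L}"
    then show "x \<in> incid K"
      using f(2) by (auto simp: remove_hyperplane_def restrict_to_def)
  qed
  then have "K = gluing ?K1 f ?K2"
    using HK within_lines
    by (intro incidence_structure.equality) (auto simp: gluing_def K1_sets K2_sets)
  then show ?thesis using K1 K2 K2' bij data by blast
qed

end
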